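(* Let $k \geq 3$ be an integer. If a multiplicative function $f : \mathbb{N} \to \mathbb{C}$ satisfies \[ f(a_1^3 + a_2^3 + \cdots + a_k^3) = f(a_1^3) + f(a_2^3) + \cdots + f(a_k^3) \] for all $a_1, a_2, \ldots, a_k \in \mathbb{N}$, then $f$ is the identity function, i.e. $f(n) = n$ for all $n \in \mathbb{N}$.
   Context: $\mathbb{N}$ denotes the set of positive integers. A function $f : \mathbb{N} \to \mathbb{C}$ is multiplicative if $f(1) = 1$ and $f(mn) = f(m) f(n)$ whenever $\gcd(m,n) = 1$. *)

theory Defs
  imports Complex_Main
begin

(* A function on the positive integers is represented by a total function on nat; its value
   at 0 is junk and is never constrained. *)
definition multiplicative :: "(nat \<Rightarrow> complex) \<Rightarrow> bool" where
  "multiplicative f \<longleftrightarrow>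
     f 1 = 1 \<and> (\<forall>m n. m > 0 \<longrightarrow> n > 0 \<longrightarrow> coprime m n \<longrightarrow> f (m * n) = f m * f n)"

end

theory Submission
  imports Defs "HOL-Computational_Algebra.Primes"
begin

text \<open>
  Put \<open>g n = f (n\<^sup>3)\<close>. Padding with ones, equal sums of three cubes yield linear relations for \<open>g\<close>,
  and these force \<open>g n = A n\<^sup>3 + B + C chi3 n + D chi7 n\<close> for small \<open>n\<close>. The four summands are independent
  multiplicative functions, so multiplicativity leaves only one of them; the last three contradict
  numerical instances of the hypothesis, and the identity
  \<open>(5m + j)\<^sup>3 + (3m - j)\<^sup>3 + (m + 2j)\<^sup>3 = (5m)\<^sup>3 + (3m + 2j)\<^sup>3 + m\<^sup>3\<close> propagates \<open>g n = n\<^sup>3\<close> to all \<open>n\<close>.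
  Hence \<open>f\<close> fixes every sum of \<open>k\<close> positive cubes. For a prime \<open>p \<noteq> 3\<close>, Ryley's parametrisation of a
  number by three positive rational cubes gives \<open>c\<close> prime to \<open>p\<close> such that \<open>p\<^sup>r c\<^sup>3\<close> is a sum of \<open>k\<close>
  positive cubes, so \<open>f (p\<^sup>r) = p\<^sup>r\<close>. For \<open>p = 3\<close> it then suffices to write some \<open>3\<^sup>r m\<close> with \<open>m\<close> prime
  to 3 as such a sum.
\<close>

section \<open>Multiplicative functions\<close>

lemma coprime_mult_add_1: "coprime (a * b + 1) (a :: nat)"
  by (rule coprimeI) (meson dvd_add_right_iff dvd_mult2)

lemma multiplicative_1: "multiplicative f \<Longrightarrow> f 1 = 1"
  by (simp add: multiplicative_def)

lemma multiplicative_mult: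
  "\<lbrakk>multiplicative f; m > 0; n > 0; coprime m n\<rbrakk> \<Longrightarrow> f (m * n) = f m * f n"
  by (simp add: multiplicative_def)

text \<open>Splits off the full power of one prime at a time. Only primes dividing \<open>n\<close>
  enter the hypothesis, so numbers prime to 3 can be settled before the powers of 3.\<close>

lemma multiplicative_eq_of_nat:
  assumes "multiplicative f" "n > 0"
    and "\<And>p r. \<lbrakk>prime p; p dvd n\<rbrakk> \<Longrightarrow> f (p ^ r) = of_nat (p ^ r)"
  shows "f n = of_nat n"
  using assms(2,3)
proof (induction n rule: less_induct)
  case (less n)
  show ?case
  proof (cases "n = 1")
    case True
    then show ?thesis using multiplicative_1[OF assms(1)] by simp
  next
    case False
    then obtain p where p: "prime p" "p dvd n"
      using prime_factor_nat by blast
    have "n \<noteq> 0" "\<not> is_unit p" using less.prems p by auto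
    then obtain m where m: "n = p ^ multiplicity p n * m" "\<not> p dvd m"
      using multiplicity_decompose' by blast
    define r where "r = multiplicity p n"
    have n: "n = p ^ r * m" using m r_def by simp
    have "r > 0" using p \<open>n \<noteq> 0\<close> unfolding r_def
      by (simp add: prime_multiplicity_gt_zero_iff)
    have "m > 0" using n \<open>n \<noteq> 0\<close> by (cases m) auto
    have "p ^ r > 1" using prime_gt_1_nat[OF p(1)] \<open>r > 0\<close> by (intro one_less_power)
    then have "m < n" using n \<open>m > 0\<close> by simp
    have "f m = of_nat m"
      using less.IH[OF \<open>m < n\<close> \<open>m > 0\<close>] less.prems(2) n by simp
    moreover have "coprime (p ^ r) m"
      using p(1) m(2) by (simp add: prime_imp_coprime)
    moreover have "f (p ^ r) = of_nat (p ^ r)" using less.prems(2) p by blast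
    ultimately show ?thesis
      using multiplicative_mult[OF assms(1) _ \<open>m > 0\<close>, of "p ^ r"] n \<open>p ^ r > 1\<close>
      by (metis bot_nat_0.not_eq_extremum not_less_zero of_nat_mult)
  qed
qed

section \<open>Functions respecting equal sums of three cubes\<close>

definition cube_balanced :: "(nat \<Rightarrow> complex) \<Rightarrow> bool" where
  "cube_balanced h \<longleftrightarrow> (\<forall>a b c x y z. a > 0 \<longrightarrow> b > 0 \<longrightarrow> c > 0 \<longrightarrow> x > 0 \<longrightarrow> y > 0 \<longrightarrow> z > 0 \<longrightarrow>
     a ^ 3 + b ^ 3 + c ^ 3 = x ^ 3 + y ^ 3 + z ^ 3 \<longrightarrow> h a + h b + h c = h x + h y + h z)"

lemma cube_balancedD:
  "\<lbrakk>cube_balanced h; a > 0; b > 0; c > 0; x > 0; y > 0; z > 0;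
    a ^ 3 + b ^ 3 + c ^ 3 = x ^ 3 + y ^ 3 + z ^ 3\<rbrakk> \<Longrightarrow> h a + h b + h c = h x + h y + h z"
  unfolding cube_balanced_def by blast

lemma cube_balanced_const: "cube_balanced (\<lambda>n. c)"
  by (simp add: cube_balanced_def)

lemma cube_balanced_cube: "cube_balanced (\<lambda>n. of_nat (n ^ 3))"
  unfolding cube_balanced_def of_nat_add[symmetric] by simp

lemma cube_balanced_diff:
  assumes "cube_balanced g" "cube_balanced h"
  shows "cube_balanced (\<lambda>n. g n - h n)"
  unfolding cube_balanced_def
proof (intro allI impI)
  fix a b c x y z :: nat
  assume hyps: "a > 0" "b > 0" "c > 0" "x > 0" "y > 0" "z > 0"
    "a ^ 3 + b ^ 3 + c ^ 3 = x ^ 3 + y ^ 3 + z ^ 3"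
  have "(g a + g b + g c) - (h a + h b + h c) = (g x + g y + g z) - (h x + h y + h z)"
    unfolding cube_balancedD[OF assms(1) hyps] cube_balancedD[OF assms(2) hyps] ..
  then show "g a - h a + (g b - h b) + (g c - h c) = g x - h x + (g y - h y) + (g z - h z)"
    by (simp only: diff_conv_add_uminus minus_add_distrib ac_simps)
qed

text \<open>
  Cubes are congruent to 0, 1 or -1 modulo 9 and modulo 7; \<open>chi3\<close> and \<open>chi7\<close> record this residue. They
  respect equal sums of three cubes because -3, ..., 3 are distinct modulo 7 and modulo 9.
\<close>

definition chi3 :: "nat \<Rightarrow> complex" where
  "chi3 n = (if n mod 3 = 0 then 0 else if n mod 3 = 1 then 1 else - 1)"

definition chi7 :: "nat \<Rightarrow> complex" where
  "chi7 n = (if n mod 7 = 0 then 0 else if n mod 7 \<in> {1, 2, 4} then 1 else - 1)"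

text \<open>Eleven linear relations determine the fifteen values from \<open>h 1\<close>, ...,
  \<open>h 4\<close>, so it suffices to match a combination of the four model functions
  there.\<close>

lemma cube_balanced_small_values:
  assumes "cube_balanced h"
  obtains A B C D where
    "\<And>n. n \<in> {1..15} \<Longrightarrow> h n = A * of_nat (n ^ 3) + B + C * chi3 n + D * chi7 n"
proof -
  note R = cube_balancedD[OF assms]
  have rels:
    "h 1 + h 5 + h 5 = h 2 + h 3 + h 6"
    "h 1 + h 2 + h 10 = h 4 + h 6 + h 9"
    "h 2 + h 3 + h 11 = h 5 + h 8 + h 9"
    "h 1 + h 9 + h 9 = h 4 + h 4 + h 11"
    "h 1 + h 1 + h 12 = h 1 + h 9 + h 10"
    "h 2 + h 3 + h 12 = h 6 + h 6 + h 11"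
    "h 1 + h 6 + h 13 = h 7 + h 7 + h 12"
    "h 2 + h 10 + h 12 = h 3 + h 8 + h 13"
    "h 2 + h 2 + h 15 = h 9 + h 11 + h 11"
    "h 1 + h 6 + h 15 = h 4 + h 11 + h 13"
    "h 2 + h 6 + h 15 = h 7 + h 8 + h 14"
    by (rule R; simp)+
  \<comment> \<open>The coefficients solve \<open>F i = h i\<close> for
    \<open>i = 1, 2, 3, 4\<close>.\<close>
  define A where "A = (h 4 - h 1) / 63"
  define D where "D = (h 1 + h 2 - 2 * h 3 + 45 * A) / 4"
  define C where "C = (h 1 - h 2 + 7 * A) / 2"
  define B where "B = h 1 - A - C - D"
  have defs: "63 * A = h 4 - h 1" "4 * D = h 1 + h 2 - 2 * h 3 + 45 * A"
    "2 * C = h 1 - h 2 + 7 * A" "B = h 1 - A - C - D"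
    unfolding A_def D_def C_def B_def by simp_all
  define F where "F n = A * of_nat (n ^ 3) + B + C * chi3 n + D * chi7 n" for n
  define e where "e n = h n - F n" for n
  have F: "F 1 = A + B + C + D" "F 2 = 8 * A + B - C + D" "F 3 = 27 * A + B - D"
    "F 4 = 64 * A + B + C + D" "F 5 = 125 * A + B - C - D" "F 6 = 216 * A + B - D"
    "F 7 = 343 * A + B + C" "F 8 = 512 * A + B - C + D" "F 9 = 729 * A + B + D"
    "F 10 = 1000 * A + B + C - D" "F 11 = 1331 * A + B - C + D" "F 12 = 1728 * A + B - D"
    "F 13 = 2197 * A + B + C - D" "F 14 = 2744 * A + B - C" "F 15 = 3375 * A + B + D"
    unfolding F_def chi3_def chi7_def by simp_all
  have h: "h n = e n + F n" for n unfolding e_def by simp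
  have e0: "e 1 = 0" "e 2 = 0" "e 3 = 0" "e 4 = 0"
    using defs unfolding e_def F complex_eq_iff by simp_all
  have r: "2 * e 5 = e 6" "e 10 = e 6 + e 9" "e 11 = e 5 + e 8 + e 9" "2 * e 9 = e 11"
    "e 12 = e 9 + e 10" "e 12 = 2 * e 6 + e 11" "e 6 + e 13 = 2 * e 7 + e 12"
    "e 10 + e 12 = e 8 + e 13" "e 15 = e 9 + 2 * e 11" "e 6 + e 15 = e 11 + e 13"
    "e 6 + e 15 = e 7 + e 8 + e 14"
    using rels unfolding h F e0 complex_eq_iff by simp_all
  \<comment> \<open>Two expressions for \<open>e 12\<close> give \<open>e 6 = 2 * e 6\<close>;
    below, two expressions for \<open>e 15\<close> force \<open>e 9 = 0\<close>.\<close>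
  have e5: "e 5 = 0" using r(1,2,4,5,6) by (simp add: complex_eq_iff)
  have e6: "e 6 = 0" using r(1) e5 by simp
  have e9: "e 9 = 0" using r(2,3,4,5,8,9,10) e5 e6 by (simp add: complex_eq_iff)
  have e10: "e 10 = 0" "e 11 = 0" "e 12 = 0" using r(2,4,5) e6 e9 by simp_all
  have e8: "e 8 = 0" "e 13 = 0" "e 15 = 0" using r(3,8,9) e5 e9 e10 by simp_all
  have e7: "e 7 = 0" using r(7) e6 e10 e8 by simp
  have e14: "e 14 = 0" using r(11) e6 e7 e8 by simp
  have "h n = F n" if n: "n \<in> {1..15}" for n
  proof -
    have "n \<in> {..15}" "n \<noteq> 0" using n by auto
    then have "n \<in> {1,2,3,4,5,6,7,8,9,10,11,12,13,14,15}"
      by (auto simp: atMost_nat_numeral simp del: atMost_iff)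
    then have "e n = 0" using e0 e5 e6 e7 e8 e9 e10 e14 by blast
    then show ?thesis using h by simp
  qed
  then show ?thesis using that unfolding F_def by blast
qed

section \<open>Propagation from the first four values\<close>

lemma cube_identity:
  fixes m j d :: nat
  assumes "3 * m = j + d"
  shows "(5 * m + j) ^ 3 + d ^ 3 + (m + 2 * j) ^ 3 = (5 * m) ^ 3 + (3 * m + 2 * j) ^ 3 + m ^ 3"
proof -
  have d: "int d = 3 * int m - int j" using assms by linarith
  have "int ((5 * m + j) ^ 3 + d ^ 3 + (m + 2 * j) ^ 3)
      = int ((5 * m) ^ 3 + (3 * m + 2 * j) ^ 3 + m ^ 3)"
    by (simp add: d algebra_simps power3_eq_cube)
  then show ?thesis by (simp only: of_nat_eq_iff)
qed

text \<open>The case \<open>j = -1\<close> of \<open>cube_identity\<close>, with \<open>e\<close>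
  for \<open>m - 2\<close>. It serves the multiples of 5, where \<open>j = 0\<close> gives a trivial
  identity.\<close>

lemma cube_identity_minus:
  fixes m :: nat
  assumes "m = e + 2"
  shows "(5 * m) ^ 3 + (3 * m - 2) ^ 3 + m ^ 3 = (5 * m - 1) ^ 3 + (3 * m + 1) ^ 3 + e ^ 3"
  unfolding assms by (simp add: algebra_simps power3_eq_cube)

lemma cube_balanced_eq_0:
  assumes h: "cube_balanced h" and "h 1 = 0" "h 2 = 0" "h 3 = 0" "h 4 = 0" and "n > 0"
  shows "h n = 0"
  using \<open>n > 0\<close>
proof (induction n rule: less_induct)
  case (less n)
  show ?case
  proof (cases "n \<le> 15")
    case True
    obtain A B C D where v: "\<And>n. n \<in> {1..15} \<Longrightarrow> h n = A * of_nat (n ^ 3) + B + C * chi3 n + D * chi7 n"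
      using cube_balanced_small_values[OF h] by blast
    have "A + B + C + D = 0" "8 * A + B - C + D = 0" "27 * A + B - D = 0" "64 * A + B + C + D = 0"
      using v[of 1] v[of 2] v[of 3] v[of 4] assms(2-5) by (simp_all add: chi3_def chi7_def mult.commute)
    then have "A = 0 \<and> B = 0 \<and> C = 0 \<and> D = 0"
      by (simp add: complex_eq_iff)
    then show ?thesis using v[of n] True less.prems by simp
  next
    case False
    \<comment> \<open>In either identity used below, the five arguments other than \<open>n\<close>
      are positive and smaller than \<open>n\<close>.\<close>
    define m j where "m = n div 5" and "j = n mod 5"
    have n: "n = 5 * m + j" "j < 5" "m \<ge> 3" using False unfolding m_def j_def by auto
    show ?thesis
    proof (cases "j = 0")
      case True
      then have "m \<ge> 4" using n False by simp
      then have e: "m = (m - 2) + 2" "m - 2 > 0" by simp_all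
      have "h n + h (3 * m - 2) + h m = h (5 * m - 1) + h (3 * m + 1) + h (m - 2)"
        using cube_balancedD[OF h _ _ _ _ _ _ cube_identity_minus[OF e(1)]] e n True by simp
      moreover have "h (3 * m - 2) = 0" "h m = 0" "h (5 * m - 1) = 0" "h (3 * m + 1) = 0" "h (m - 2) = 0"
        by (rule less.IH; use e n True in linarith)+
      ultimately show ?thesis by simp
    next
      case False
      define d where "d = 3 * m - j"
      have d: "3 * m = j + d" "d > 0" using n unfolding d_def by auto
      have "h n + h d + h (m + 2 * j) = h (5 * m) + h (3 * m + 2 * j) + h m"
        using cube_balancedD[OF h _ _ _ _ _ _ cube_identity[OF d(1)]] d n by simp
      moreover have "h d = 0" "h (m + 2 * j) = 0" "h (5 * m) = 0" "h (3 * m + 2 * j) = 0" "h m = 0"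
        by (rule less.IH; use d n False in linarith)+
      ultimately show ?thesis by simp
    qed
  qed
qed

text \<open>The value \<open>g 2\<close> selects the function, except that the constant 1 and
  \<open>chi7\<close> agree at 2; their mixtures are excluded by \<open>g 15 = g 3 * g 5\<close>.
  For \<open>chi3\<close> and \<open>chi7\<close> small values suffice to reach a contradiction
  later.\<close>

lemma cube_balanced_multiplicative_cases:
  assumes g: "cube_balanced g" and g1: "g 1 = 1"
    and mult: "\<And>m n. \<lbrakk>m > 0; n > 0; coprime m n\<rbrakk> \<Longrightarrow> g (m * n) = g m * g n"
  shows "(\<forall>n>0. g n = of_nat (n ^ 3)) \<or> (\<forall>n>0. g n = 1)
    \<or> (\<forall>n\<in>{1..15}. g n = chi3 n) \<or> (\<forall>n\<in>{1..15}. g n = chi7 n)"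
proof -
  obtain A B C D where v: "\<And>n. n \<in> {1..15} \<Longrightarrow> g n = A * of_nat (n ^ 3) + B + C * chi3 n + D * chi7 n"
    using cube_balanced_small_values[OF g] by blast
  note v' = v[simplified chi3_def chi7_def]
  have vals: "A + B + C + D = 1" "g 2 = 8 * A + B - C + D" "g 3 = 27 * A + B - D"
    "g 4 = 64 * A + B + C + D" "g 5 = 125 * A + B - C - D" "g 6 = 216 * A + B - D"
    "g 7 = 343 * A + B + C" "g 10 = 1000 * A + B + C - D" "g 14 = 2744 * A + B - C"
    "g 15 = 3375 * A + B + D"
    using v'[of 1] v'[of 2] v'[of 3] v'[of 4] v'[of 5] v'[of 6] v'[of 7] v'[of 10] v'[of 14] v'[of 15] g1
    by simp_all
  have m6: "g 6 = g 2 * g 3" and m10: "g 10 = g 2 * g 5" and m14: "g 14 = g 2 * g 7"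
    and m15: "g 15 = g 3 * g 5"
    using mult[of 2 3] mult[of 2 5] mult[of 2 7] mult[of 3 5] by (simp_all add: coprime_iff_gcd_eq_1 gcd_non_0_nat)
  \<comment> \<open>Comparing \<open>g (2 n)\<close> with \<open>g 2 * g n\<close> for \<open>n = 1, 3, 5, 7\<close>: by linear independence each
    coefficient vanishes unless \<open>g 2\<close> is the value at 2 of its function.\<close>
  define a b c d where "a = A * (8 - g 2)" and "b = B * (1 - g 2)" and "c = C * (- 1 - g 2)"
    and "d = D * (1 - g 2)"
  have "a + b + c + d = g 2 - g 2 * (A + B + C + D)"
    unfolding a_def b_def c_def d_def vals(2-) by (simp add: algebra_simps)
  then have 1: "a + b + c + d = 0" using vals(1) by simp
  have "27 * a + b - d = g 6 - g 2 * g 3"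
    unfolding a_def b_def c_def d_def vals(2-) by (simp add: algebra_simps)
  then have 2: "27 * a + b - d = 0" using m6 by simp
  have "125 * a + b - c - d = g 10 - g 2 * g 5"
    unfolding a_def b_def c_def d_def vals(2-) by (simp add: algebra_simps)
  then have 3: "125 * a + b - c - d = 0" using m10 by simp
  have "343 * a + b + c = g 14 - g 2 * g 7"
    unfolding a_def b_def c_def d_def vals(2-) by (simp add: algebra_simps)
  then have 4: "343 * a + b + c = 0" using m14 by simp
  have "a = 0 \<and> b = 0 \<and> c = 0 \<and> d = 0"
    using 1 2 3 4 by (simp add: complex_eq_iff)
  then have z: "A = 0 \<or> g 2 = 8" "B = 0 \<or> g 2 = 1" "C = 0 \<or> g 2 = - 1" "D = 0 \<or> g 2 = 1"
    unfolding a_def b_def c_def d_def mult_eq_0_iff right_minus_eq by auto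
  consider "g 2 = 8" | "g 2 = 1" | "g 2 = - 1" using z vals(1) by auto
  then show ?thesis
  proof cases
    case 1
    then have "B = 0" "C = 0" "D = 0" using z by auto
    then have "A = 1" using vals(1) by simp
    define h where "h n = g n - of_nat (n ^ 3)" for n
    have "cube_balanced h"
      unfolding h_def by (intro cube_balanced_diff g cube_balanced_cube)
    moreover have "h 1 = 0" "h 2 = 0" "h 3 = 0" "h 4 = 0"
      using g1 vals \<open>A = 1\<close> \<open>B = 0\<close> \<open>C = 0\<close> \<open>D = 0\<close> by (simp_all add: h_def)
    ultimately have "h n = 0" if "n > 0" for n using cube_balanced_eq_0 that by blast
    then show ?thesis by (simp add: h_def)
  next
    case 2
    then have "A = 0" "C = 0" using z by auto
    have BD: "B + D = 1" using vals(1) \<open>A = 0\<close> \<open>C = 0\<close> by simp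
    then have "(B - D) * (B - D) = 1" using m15 vals \<open>A = 0\<close> \<open>C = 0\<close> by simp
    then have "B - D = 1 \<or> B - D = - 1" by (simp add: square_eq_1_iff)
    then have "(B = 1 \<and> D = 0) \<or> (B = 0 \<and> D = 1)"
      using BD by (auto simp: complex_eq_iff)
    then show ?thesis
    proof
      assume B: "B = 1 \<and> D = 0"
      define h where "h n = g n - 1" for n
      have "cube_balanced h"
        unfolding h_def by (intro cube_balanced_diff g cube_balanced_const)
      moreover have "h 1 = 0" "h 2 = 0" "h 3 = 0" "h 4 = 0"
        using g1 vals \<open>A = 0\<close> B \<open>C = 0\<close> by (simp_all add: h_def)
      ultimately have "h n = 0" if "n > 0" for n using cube_balanced_eq_0 that by blast
      then show ?thesis by (simp add: h_def)
    next
      assume "B = 0 \<and> D = 1"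
      then have "g n = chi7 n" if "n \<in> {1..15}" for n
        using v[OF that] \<open>A = 0\<close> \<open>C = 0\<close> by simp
      then show ?thesis by blast
    qed
  next
    case 3
    then have "A = 0" "B = 0" "D = 0" using z by auto
    then have "C = 1" using vals(1) by simp
    then have "g n = chi3 n" if "n \<in> {1..15}" for n
      using v[OF that] \<open>A = 0\<close> \<open>B = 0\<close> \<open>D = 0\<close> by simp
    then show ?thesis by blast
  qed
qed

section \<open>Additivity on sums of positive cubes\<close>

text \<open>Lists replace indexed families, so that padding is concatenation and numerical instances
  are literals.\<close>

definition cube_additive :: "nat \<Rightarrow> (nat \<Rightarrow> complex) \<Rightarrow> bool" where
  "cube_additive k f \<longleftrightarrow> (\<forall>xs. length xs = k \<longrightarrow> 0 \<notin> set xs \<longrightarrow>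
     f (\<Sum>x\<leftarrow>xs. x ^ 3) = (\<Sum>x\<leftarrow>xs. f (x ^ 3)))"

lemma cube_additiveD:
  "\<lbrakk>cube_additive k f; length xs = k; 0 \<notin> set xs\<rbrakk> \<Longrightarrow> f (\<Sum>x\<leftarrow>xs. x ^ 3) = (\<Sum>x\<leftarrow>xs. f (x ^ 3))"
  unfolding cube_additive_def by blast

lemma cube_additive_relation:
  assumes f: "cube_additive k f" and len: "length xs \<le> k" "length ys = length xs"
    and pos: "0 \<notin> set xs" "0 \<notin> set ys" and eq: "(\<Sum>x\<leftarrow>xs. x ^ 3) = (\<Sum>x\<leftarrow>ys. x ^ 3)"
  shows "(\<Sum>x\<leftarrow>xs. f (x ^ 3)) = (\<Sum>x\<leftarrow>ys. f (x ^ 3))"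
proof -
  define zs where "zs = replicate (k - length xs) (1 :: nat)"
  have "(\<Sum>x\<leftarrow>xs @ zs. f (x ^ 3)) = (\<Sum>x\<leftarrow>ys @ zs. f (x ^ 3))"
    using cube_additiveD[OF f, of "xs @ zs"] cube_additiveD[OF f, of "ys @ zs"] len pos eq
    by (simp add: zs_def)
  then show ?thesis by simp
qed

lemma cube_additive_imp_cube_balanced:
  assumes "cube_additive k f" "k \<ge> 3"
  shows "cube_balanced (\<lambda>n. f (n ^ 3))"
  unfolding cube_balanced_def
proof (intro allI impI)
  fix a b c x y z :: nat
  assume "a > 0" "b > 0" "c > 0" "x > 0" "y > 0" "z > 0"
    "a ^ 3 + b ^ 3 + c ^ 3 = x ^ 3 + y ^ 3 + z ^ 3"
  then show "f (a ^ 3) + f (b ^ 3) + f (c ^ 3) = f (x ^ 3) + f (y ^ 3) + f (z ^ 3)"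
    using cube_additive_relation[OF assms(1), of "[a, b, c]" "[x, y, z]"] assms(2)
    by (simp add: add.assoc)
qed

text \<open>Serves to rule out \<open>g = 1\<close>, which would give \<open>k = 1\<close>.
  Replacing one cube by three adds two summands, so the induction starts from 3 and 4.\<close>

lemma cube_eq_sum_of_cubes:
  fixes k :: nat
  assumes "k \<ge> 3"
  shows "\<exists>(c :: nat) (xs :: nat list). c > 0 \<and> length xs = k \<and> 0 \<notin> set xs \<and> (\<Sum>x\<leftarrow>xs. x ^ 3) = c ^ 3"
  using assms
proof (induction k rule: less_induct)
  case (less k)
  consider "k = 3" | "k = 4" | "k \<ge> 5" using less.prems by linarith
  then show ?case
  proof cases
    case 1
    then show ?thesis by (intro exI[of _ 6] exI[of _ "[3, 4, 5]"]) simp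
  next
    case 2
    then show ?thesis by (intro exI[of _ 13] exI[of _ "[5, 7, 9, 10]"]) simp
  next
    case 3
    then obtain c :: nat and xs :: "nat list" where xs: "c > 0" "length xs = k - 2" "0 \<notin> set xs" "(\<Sum>x\<leftarrow>xs. x ^ 3) = c ^ 3"
      using less.IH[of "k - 2"] by (auto simp: le_diff_conv2)
    then obtain y ys where y: "xs = y # ys" using 3 by (cases xs) auto
    \<comment> \<open>After scaling by 6, split one cube by means of \<open>6\<^sup>3 = 3\<^sup>3 + 4\<^sup>3 + 5\<^sup>3\<close>.\<close>
    have "(\<Sum>x\<leftarrow>map ((*) 6) ys @ [3 * y, 4 * y, 5 * y]. x ^ 3) = 216 * (\<Sum>x\<leftarrow>xs. x ^ 3)"
      by (simp add: y o_def power_mult_distrib sum_list_const_mult)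
    also have "\<dots> = (6 * c) ^ 3" by (simp add: xs(4) power_mult_distrib)
    finally show ?thesis
      using xs 3 y
      by (intro exI[of _ "6 * c"] exI[of _ "map ((*) 6) ys @ [3 * y, 4 * y, 5 * y]"]) auto
  qed
qed

lemma cube_additive_on_cubes:
  assumes f: "cube_additive k f" and k: "k \<ge> 3" and m: "multiplicative f" and "n > 0"
  shows "f (n ^ 3) = of_nat (n ^ 3)"
proof -
  define g where "g n = f (n ^ 3)" for n
  have g1: "g 1 = 1" using multiplicative_1[OF m] by (simp add: g_def)
  have mult: "g (a * b) = g a * g b" if "a > 0" "b > 0" "coprime a b" for a b
    using multiplicative_mult[OF m, of "a ^ 3" "b ^ 3"] that by (simp add: g_def power_mult_distrib)
  have g: "cube_balanced g"
    unfolding g_def by (rule cube_additive_imp_cube_balanced[OF f k])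
  note rel = cube_additive_relation[OF f, folded g_def]
  note sum = cube_additiveD[OF f, folded g_def]
  note mf = multiplicative_mult[OF m]
  have cop: "coprime 3 (43::nat)" "coprime 3 (136::nat)" "coprime 4 (11::nat)"
    by (simp_all add: coprime_iff_gcd_eq_1 gcd_non_0_nat)
  consider (cube) "\<forall>n>0. g n = of_nat (n ^ 3)" | (one) "\<forall>n>0. g n = 1"
    | (chi3) "\<forall>n\<in>{1..15}. g n = chi3 n" | (chi7) "\<forall>n\<in>{1..15}. g n = chi7 n"
    using cube_balanced_multiplicative_cases[OF g g1 mult] by blast
  then show ?thesis
  proof cases
    case cube
    then show ?thesis using \<open>n > 0\<close> by (simp add: g_def)
  next
    case one
    obtain c :: nat and xs :: "nat list" where xs: "c > 0" "length xs = k" "0 \<notin> set xs" "(\<Sum>x\<leftarrow>xs. x ^ 3) = c ^ 3"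
      using cube_eq_sum_of_cubes[OF k] by blast
    have "map g xs = map (\<lambda>_. 1) xs"
      using one xs(3) by (intro map_cong refl) (metis gr0I)
    then have "(\<Sum>x\<leftarrow>xs. g x) = of_nat k"
      using xs(2) by (simp only: sum_list_triv mult_1_right)
    then have "g c = of_nat k" using sum[OF xs(2,3)] xs(4) by (simp add: g_def)
    then have "k = 1" using one xs(1) by simp
    then show ?thesis using k by simp
  next
    case chi3
    then have v: "g 1 = 1" "g 2 = - 1" "g 3 = 0" "g 4 = 1" "g 5 = - 1"
      by (simp_all add: chi3_def)
    \<comment> \<open>Sums of at most four values of \<open>chi3\<close> are determined modulo 9, so
      \<open>k = 3\<close> and \<open>k = 4\<close> need multiplicativity, at 129 = 3 * 43 and 44 =
      4 * 11. With five cubes the sums 4 and -5 are congruent modulo 9.\<close>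
    consider "k = 3" | "k = 4" | "k \<ge> 5" using k by linarith
    then show ?thesis
    proof cases
      case 1
      have "f 3 = 3" "f 43 = - 2" "f 129 = 3"
        using sum[of "[1, 1, 1]"] sum[of "[2, 2, 3]"] sum[of "[1, 4, 4]"] v 1 by (simp_all flip: numeral_3_eq_3)
      then show ?thesis using mf[of 3 43] cop by simp
    next
      case 2
      have "f 4 = 4" "f 11 = 2" "f 44 = - 1"
        using sum[of "[1, 1, 1, 1]"] sum[of "[1, 1, 1, 2]"] sum[of "[1, 2, 2, 3]"] v 2 by (simp_all flip: numeral_3_eq_3)
      then show ?thesis using mf[of 4 11] cop by simp
    next
      case 3
      then show ?thesis using rel[of "[1, 1, 3, 4, 4]" "[2, 2, 2, 2, 5]"] v by simp
    qed
  next
    case chi7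
    then have v: "g 1 = 1" "g 2 = 1" "g 3 = - 1" "g 4 = 1" "g 7 = 0" "g 9 = 1" "g 10 = - 1"
      by (simp_all add: chi7_def)
    \<comment> \<open>Modulo 7, four cubes already suffice, through the sums 3 and -4; for
      \<open>k = 3\<close> the contradiction is at 408 = 3 * 136.\<close>
    consider "k = 3" | "k \<ge> 4" using k by linarith
    then show ?thesis
    proof cases
      case 1
      have "f 3 = 3" "f 136 = 3" "f 408 = 2"
        using sum[of "[1, 1, 1]"] sum[of "[2, 4, 4]"] sum[of "[1, 4, 7]"] v 1 by (simp_all flip: numeral_3_eq_3)
      then show ?thesis using mf[of 3 136] cop by simp
    next
      case 2
      then show ?thesis using rel[of "[1, 2, 7, 9]" "[3, 3, 3, 10]"] v by simp
    qed
  qed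
qed

lemma cube_additive_sum_of_cubes:
  assumes f: "cube_additive k f" "k \<ge> 3" "multiplicative f"
    and xs: "length xs = k" "0 \<notin> set xs"
  shows "f (\<Sum>x\<leftarrow>xs. x ^ 3) = of_nat (\<Sum>x\<leftarrow>xs. x ^ 3)"
proof -
  have "map (\<lambda>x. f (x ^ 3)) xs = map (\<lambda>x. of_nat (x ^ 3)) xs"
    using xs(2) by (intro map_cong refl cube_additive_on_cubes[OF f] gr0I) auto
  moreover have "(\<Sum>x\<leftarrow>xs. of_nat (x ^ 3) :: complex) = of_nat (\<Sum>x\<leftarrow>xs. x ^ 3)"
    by (induction xs) simp_all
  ultimately show ?thesis
    using cube_additiveD[OF f(1) xs] by (simp only:)
qed

text \<open>It is enough that a multiple of \<open>N\<close> is a sum of \<open>k\<close> positive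
  cubes, if the cofactor is coprime to \<open>N\<close> and \<open>f\<close> is known there.\<close>

lemma cube_additive_eq_of_nat:
  assumes f: "cube_additive k f" "k \<ge> 3" "multiplicative f"
    and "N > 0" "c > 0" "f c = of_nat c" "coprime N c"
    and xs: "length xs = k" "0 \<notin> set xs" "(\<Sum>x\<leftarrow>xs. x ^ 3) = N * c"
  shows "f N = of_nat N"
proof -
  have "f N * f c = of_nat (N * c)"
    using cube_additive_sum_of_cubes[OF f xs(1,2)] multiplicative_mult[OF f(3)] assms(4-7) xs(3) by simp
  then show ?thesis using assms(5,6) by simp
qed

section \<open>Prime powers\<close>

lemma ryley_identity:
  fixes u w x y :: nat
  assumes "u ^ 3 = w ^ 3 + x" "3 * u * w ^ 2 + w ^ 3 = u ^ 3 + y"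
  shows "9 * u * w ^ 2 * (u ^ 2 + u * w + w ^ 2) ^ 3
    = x ^ 3 + y ^ 3 + (3 * u ^ 2 * w + 3 * u * w ^ 2) ^ 3"
proof -
  have x: "int x = int u ^ 3 - int w ^ 3"
    using arg_cong[OF assms(1), of int] by simp
  have y: "int y = 3 * int u * int w ^ 2 + int w ^ 3 - int u ^ 3"
    using arg_cong[OF assms(2), of int] by simp
  have "int (9 * u * w ^ 2 * (u ^ 2 + u * w + w ^ 2) ^ 3)
      = int (x ^ 3 + y ^ 3 + (3 * u ^ 2 * w + 3 * u * w ^ 2) ^ 3)"
    unfolding of_nat_add of_nat_mult of_nat_power of_nat_numeral x y by algebra
  then show ?thesis by (simp only: of_nat_eq_iff)
qed

text \<open>Because \<open>p\<close> divides \<open>N\<close>, it divides \<open>u\<close>, so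
  \<open>u^2 + u * w + w^2\<close> is congruent to \<open>w^2\<close> modulo \<open>p\<close>; this
  keeps \<open>c\<close> prime to \<open>p\<close>.\<close>

lemma prime_dvd_sum_of_three_cubes:
  fixes p N :: nat
  assumes p: "prime p" "p \<noteq> 3" and N: "p dvd N" "N > 0"
  shows "\<exists>c x y z. c > 0 \<and> x > 0 \<and> y > 0 \<and> z > 0 \<and> coprime p c \<and> N * c ^ 3 = x ^ 3 + y ^ 3 + z ^ 3"
proof -
  \<comment> \<open>The last parameter of the identity has to satisfy \<open>w < u \<le> 9 w / 5\<close> for all three cubes to be
    positive. The choice \<open>u = N a\<^sup>3\<close>, \<open>w = 9 b\<^sup>3\<close> turns \<open>9 u w\<^sup>2\<close> into \<open>N (9 a b\<^sup>2)\<^sup>3\<close>.\<close>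
  define a u where "a = 23 * p + 1" and "u = N * a ^ 3"
  have pa: "\<not> p dvd a"
    using p(1) unfolding a_def by (metis dvd_add_right_iff dvd_triv_right not_prime_unit)
  define q where "q = (LEAST q. u \<le> 9 * q ^ 3)"
  have "u \<le> 9 * u ^ 3" by (cases "u = 0") (auto simp: power3_eq_cube)
  then have q: "u \<le> 9 * q ^ 3" unfolding q_def by (rule LeastI)
  have q_less: "9 * b ^ 3 < u" if "b < q" for b
    using not_less_Least[OF that[unfolded q_def]] by simp
  have "24 ^ 3 \<le> a ^ 3"
    using prime_gt_0_nat[OF p(1)] unfolding a_def by (intro power_mono) simp_all
  also have "a ^ 3 \<le> u" using N(2) by (simp add: u_def)
  finally have "24 ^ 3 \<le> u" .
  \<comment> \<open>From 12 on, \<open>5 * q^3 \<le> 9 * (q - 2)^3\<close>, so \<open>b\<close> may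
    be either \<open>q - 1\<close> or \<open>q - 2\<close>, whichever is prime to \<open>p\<close>.
    The bound holds as \<open>24^3 > 9 * 11^3\<close>.\<close>
  have "q \<ge> 12"
  proof (rule ccontr)
    assume "\<not> q \<ge> 12"
    then have "q ^ 3 \<le> 11 ^ 3" by (intro power_mono) simp_all
    then show False using q \<open>24 ^ 3 \<le> u\<close> by simp
  qed
  then obtain t where t: "q = t + 12" by (metis le_add_diff_inverse2)
  have consecutive: "\<not> (p dvd t + 10 \<and> p dvd (t + 10) + 1)"
    using p(1) dvd_add_right_iff not_prime_unit by blast
  define b where "b = (if p dvd t + 10 then t + 11 else t + 10)"
  have b: "b \<ge> t + 10" "b < q" by (simp_all add: b_def t)
  have pb: "\<not> p dvd b" using consecutive by (auto simp: b_def add.commute)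
  define w where "w = 9 * b ^ 3"
  have "w < u" using q_less[OF b(2)] by (simp add: w_def)
  have "w > 0" using b by (simp add: w_def)
  have "5 * q ^ 3 \<le> 9 * (t + 10) ^ 3"
    unfolding t by (simp add: power3_eq_cube algebra_simps)
  also have "\<dots> \<le> 9 * b ^ 3" using b(1) by (intro mult_left_mono power_mono) simp_all
  finally have uw: "5 * u \<le> 9 * w" using q by (simp add: w_def)
  have "25 * (u * u) \<le> 81 * (w * w)"
    using mult_mono[OF uw uw] by simp
  then have "25 * u ^ 3 \<le> 81 * (u * w ^ 2)"
    using mult_left_mono[of "25 * (u * u)" "81 * (w * w)" u]
    by (simp add: power2_eq_square power3_eq_cube ac_simps)
  moreover have "5 * (u * w ^ 2) \<le> 9 * w ^ 3"
    using mult_right_mono[OF uw, of "w ^ 2"] by (simp add: power2_eq_square power3_eq_cube ac_simps)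
  moreover have "w ^ 3 > 0" using \<open>w > 0\<close> by simp
  \<comment> \<open>Here 81/25 = 3 + 6/25, and 6/25 * 9/5 < 1.\<close>
  ultimately have "u ^ 3 < 3 * (u * w ^ 2) + w ^ 3" by linarith
  then have "u ^ 3 < 3 * u * w ^ 2 + w ^ 3" by (simp add: mult.assoc)
  then obtain y where y: "3 * u * w ^ 2 + w ^ 3 = u ^ 3 + y" "y > 0"
    using less_imp_add_positive by metis
  have "w ^ 3 < u ^ 3" using \<open>w < u\<close> by (intro power_strict_mono) simp_all
  then obtain x where x: "u ^ 3 = w ^ 3 + x" "x > 0" using less_imp_add_positive by metis
  define c where "c = 9 * a * b ^ 2 * (u ^ 2 + u * w + w ^ 2)"
  define z where "z = 3 * u ^ 2 * w + 3 * u * w ^ 2"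
  have "N * c ^ 3 = 9 * u * w ^ 2 * (u ^ 2 + u * w + w ^ 2) ^ 3"
    unfolding c_def u_def w_def by algebra
  also have "\<dots> = x ^ 3 + y ^ 3 + z ^ 3"
    unfolding z_def by (rule ryley_identity[OF x(1) y(1)])
  finally have "N * c ^ 3 = x ^ 3 + y ^ 3 + z ^ 3" .
  moreover have "z > 0" "c > 0"
    using \<open>w > 0\<close> \<open>w < u\<close> b(1) by (simp_all add: z_def c_def a_def)
  moreover have "coprime p c"
  proof (rule prime_imp_coprime[OF p(1)], rule notI)
    assume dvd: "p dvd c"
    have p9: "\<not> p dvd 9"
    proof
      assume "p dvd 9"
      then have "p dvd 3 ^ 2" by simp
      then have "p dvd 3" using p(1) prime_dvd_power by blast
      then show False using p primes_dvd_imp_eq[of p 3] by simp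
    qed
    have pw: "\<not> p dvd w"
      unfolding w_def using p9 pb p(1) prime_dvd_mult_iff prime_dvd_power by blast
    have pu: "p dvd u" using N(1) by (simp add: u_def)
    have "\<not> p dvd u ^ 2 + u * w + w ^ 2"
    proof
      assume "p dvd u ^ 2 + u * w + w ^ 2"
      moreover have "p dvd u ^ 2 + u * w" using pu by (simp add: power2_eq_square)
      ultimately have "p dvd w ^ 2" using dvd_add_right_iff by blast
      then show False using pw p(1) prime_dvd_power by blast
    qed
    then show False
      using dvd p9 pa pb p(1) prime_dvd_power unfolding c_def prime_dvd_mult_iff[OF p(1)] by blast
  qed
  ultimately show ?thesis using x(2) y(2) by blast
qed

section \<open>From sums of cubes to values at prime powers\<close>

lemma cube_additive_prime_power:
  assumes f: "cube_additive k f" "k \<ge> 3" "multiplicative f" and p: "prime p" "p \<noteq> 3"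
  shows "f (p ^ r) = of_nat (p ^ r)"
proof (cases "r = 0")
  case True
  then show ?thesis using multiplicative_1[OF f(3)] by simp
next
  case False
  have "p > 0" using p(1) by (rule prime_gt_0_nat)
  \<comment> \<open>This \<open>d\<close> is prime to \<open>p\<close> and so large that taking
    \<open>k - 3\<close> copies of \<open>p^3\<close> from \<open>p^r * d^3\<close> leaves a
    positive \<open>N\<close>, still divisible by \<open>p\<close>.\<close>
  define d where "d = p * k + 1"
  have pd: "coprime p d" using coprime_mult_add_1[of p k] by (simp add: d_def coprime_commute)
  have "(k - 3) * p ^ 3 \<le> k ^ 3 * p ^ 3"
    by (intro mult_right_mono order.trans[OF diff_le_self]) (simp_all add: power3_eq_cube)
  also have "\<dots> = (p * k) ^ 3" by (simp add: power_mult_distrib)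
  also have "\<dots> < d ^ 3" unfolding d_def by (intro power_strict_mono) simp_all
  also have "d ^ 3 \<le> p ^ r * d ^ 3" using \<open>p > 0\<close> by simp
  finally obtain N where N: "p ^ r * d ^ 3 = (k - 3) * p ^ 3 + N" "N > 0"
    using less_imp_add_positive by metis
  have "p dvd (k - 3) * p ^ 3 + N" unfolding N(1)[symmetric] using False by simp
  moreover have "p dvd (k - 3) * p ^ 3" by (simp add: power3_eq_cube)
  ultimately have "p dvd N" using dvd_add_right_iff by blast
  then obtain c x y z where c: "c > 0" "x > 0" "y > 0" "z > 0" "coprime p c"
    "N * c ^ 3 = x ^ 3 + y ^ 3 + z ^ 3"
    using prime_dvd_sum_of_three_cubes[OF p _ N(2)] by blast
  define xs where "xs = [x, y, z] @ replicate (k - 3) (p * c)"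
  have "d * c > 0" using c(1) by (simp add: d_def)
  show ?thesis
  proof (rule cube_additive_eq_of_nat[OF f])
    show "f ((d * c) ^ 3) = of_nat ((d * c) ^ 3)"
      by (rule cube_additive_on_cubes[OF f \<open>d * c > 0\<close>])
    show "(\<Sum>x\<leftarrow>xs. x ^ 3) = p ^ r * (d * c) ^ 3"
    proof -
      have "(\<Sum>x\<leftarrow>xs. x ^ 3) = N * c ^ 3 + (k - 3) * p ^ 3 * c ^ 3"
        unfolding c(6) xs_def by (simp add: sum_list_replicate power_mult_distrib)
      also have "\<dots> = p ^ r * d ^ 3 * c ^ 3" unfolding N(1) by (simp add: algebra_simps)
      finally show ?thesis by (simp add: power_mult_distrib)
    qed
    show "length xs = k" using f(2) by (simp add: xs_def)
    show "0 \<notin> set xs" using c \<open>p > 0\<close> by (simp add: xs_def)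
  qed (use pd c(5) \<open>d * c > 0\<close> \<open>p > 0\<close> in simp_all)
qed

lemma cube_additive_coprime_3:
  assumes f: "cube_additive k f" "k \<ge> 3" "multiplicative f" and n: "n > 0" "coprime n 3"
  shows "f n = of_nat n"
proof (rule multiplicative_eq_of_nat[OF f(3) n(1)])
  fix p r :: nat
  assume "prime p" "p dvd n"
  moreover have "p \<noteq> 3"
    using \<open>p dvd n\<close> n(2) by (auto dest: coprime_common_divisor)
  ultimately show "f (p ^ r) = of_nat (p ^ r)"
    by (intro cube_additive_prime_power[OF f])
qed

text \<open>For \<open>3^r = 9 * (t + 1)\<close>, the sum \<open>(3 * t + 2)^3 + 1\<close> equals
  \<open>3^r * (3 * t^2 + 3 * t + 1)\<close>, and adding cubes of \<open>3^r\<close> keeps the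
  cofactor 1 modulo 3. The case \<open>r = 1\<close> is separate: two cubes whose sum is divisible
  by 3 have a sum divisible by 9.\<close>

lemma cube_additive_power_3:
  assumes f: "cube_additive k f" "k \<ge> 3" "multiplicative f"
  shows "f (3 ^ r) = of_nat (3 ^ r)"
proof -
  consider "r = 0" | "r = 1" | s where "r = s + 2"
    by (metis One_nat_def add_2_eq_Suc' not0_implies_Suc)
  then show ?thesis
  proof cases
    case 1
    then show ?thesis using multiplicative_1[OF f(3)] by simp
  next
    case 2
    define m where "m = 3 * (3 * (k - 3)) + 1"
    have m: "m > 0" "coprime m 3" unfolding m_def by (simp, rule coprime_mult_add_1)
    show ?thesis
      by (rule cube_additive_eq_of_nat[OF f, of _ m "[1, 1, 1] @ replicate (k - 3) 3"])
        (use m f(2) cube_additive_coprime_3[OF f m] 2 in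
          \<open>simp_all add: sum_list_replicate m_def coprime_commute\<close>)
  next
    case 3
    obtain t where t: "3 ^ s = Suc t" by (metis not0_implies_Suc power_not_zero zero_neq_numeral)
    define m where "m = 3 * (t ^ 2 + t + (k - 2) * (27 * Suc t ^ 2)) + 1"
    have r: "3 ^ r = 9 * Suc t" by (simp add: 3 power_add t)
    have m: "m > 0" "coprime m 3" unfolding m_def by (simp, rule coprime_mult_add_1)
    have "(3 * t + 2) ^ 3 + 1 + j * (9 * Suc t) ^ 3
        = 9 * Suc t * (3 * (t ^ 2 + t + j * (27 * Suc t ^ 2)) + 1)" for j
      by (simp add: power2_eq_square power3_eq_cube algebra_simps)
    from this[of "k - 2"]
    have sum: "(\<Sum>x\<leftarrow>[3 * t + 2, 1] @ replicate (k - 2) (3 ^ r). x ^ 3) = 3 ^ r * m"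
      unfolding r m_def by (simp add: sum_list_replicate)
    show ?thesis
      by (rule cube_additive_eq_of_nat[OF f _ m(1) cube_additive_coprime_3[OF f m] _ _ _ sum])
        (use m f(2) in \<open>simp_all add: coprime_commute\<close>)
  qed
qed

theorem theorem1p1:
  fixes k :: nat and f :: "nat \<Rightarrow> complex"
  assumes "k \<ge> 3"
    and "multiplicative f"
    and "\<And>a :: nat \<Rightarrow> nat. (\<forall>i\<in>{1..k}. a i > 0) \<Longrightarrow>
           f (\<Sum>i=1..k. a i ^ 3) = (\<Sum>i=1..k. f (a i ^ 3))"
  shows "\<forall>n>0. f n = of_nat n"
proof (intro allI impI)
  fix n :: nat
  assume "n > 0"
  have f: "cube_additive k f"
    unfolding cube_additive_def
  proof (intro allI impI)
    fix xs :: "nat list"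
    assume xs: "length xs = k" "0 \<notin> set xs"
    \<comment> \<open>Shifts the indices 1, ..., \<open>k\<close> to list positions from 0; the
      range of \<open>h\<close> is polymorphic because both natural and complex sums occur.\<close>
    have eq: "(\<Sum>i=1..k. h (xs ! (i - 1))) = (\<Sum>x\<leftarrow>xs. h x)" for h :: "nat \<Rightarrow> 'a :: comm_monoid_add"
      using sum.atLeast_Suc_atMost_Suc_shift[of "\<lambda>i. h (xs ! (i - 1))" 0 "k - 1"] assms(1) xs(1)
      by (simp add: sum_list_sum_nth atLeast0LessThan lessThan_Suc_atMost[symmetric] atLeast0AtMost o_def)
    have "xs ! (i - 1) > 0" if "i \<in> {1..k}" for i
    proof -
      have "xs ! (i - 1) \<in> set xs" using that xs(1) by (intro nth_mem) auto
      then show ?thesis using xs(2) by (metis gr0I)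
    qed
    then show "f (\<Sum>x\<leftarrow>xs. x ^ 3) = (\<Sum>x\<leftarrow>xs. f (x ^ 3))"
      using assms(3)[of "\<lambda>i. xs ! (i - 1)"] eq[of "\<lambda>x. x ^ 3"] eq[of "\<lambda>x. f (x ^ 3)"] by simp
  qed
  show "f n = of_nat n"
    using cube_additive_prime_power[OF f assms(1,2)] cube_additive_power_3[OF f assms(1,2)]
    by (intro multiplicative_eq_of_nat[OF assms(2) \<open>n > 0\<close>]) metis
qed

end
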